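(* Let $r=3$, $\lambda>0$, $L=\begin{bmatrix}0&1\\-\lambda&0\end{bmatrix}$, $\Delta t=T/N$. Denote by $\{(\bm k_n,\bm z_n)\}_n$, with $\bm k_n=[\bm k_{1,n},\bm k_{2,n},\bm k_{3,n},\bm k_{4,n}]^\top$, the sequence produced by the 4-stage Lobatto IIIC Runge–Kutta scheme applied to $\dot{\bm z}=L\bm z$ with step $\Delta t$ starting from $\bm z_0\in\mathbb{R}^2$, and by $\{\widehat{\bm z}_n\}_n$ the sequence generated by the DG1 scheme $$(I_4\otimes I_2-N^4\otimes L)\,\widehat{\bm z}_{n+1}=-(N^5\otimes I_2)\,\widehat{\bm z}_n$$ starting from $\widehat{\bm z}_0\in\mathbb{R}^8$, with $N^4,N^5$ as in the context. If $[\widehat{\bm z}_0]_{7,8}=\bm z_0$, then $$[\widehat{\bm z}_n]_{7,8}=\bm z_n\quad\text{and}\quad\widehat{\bm z}_n=(I_4\otimes L^{-1})\,\bm k_{n-1}\qquad\text{for }n=1,\dots,N.$$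
   Context: $\otimes$ is the Kronecker product; $[\bm x]_{7,8}$ is the vector of the seventh and eighth components of $\bm x$. Runge–Kutta scheme: $\bm k_{i,n}=L\bigl(\bm z_n+\Delta t\sum_{j}a_{ij}\bm k_{j,n}\bigr)$, $\bm z_{n+1}=\bm z_n+\Delta t\sum_ib_i\bm k_{i,n}$, the stages being stacked in $\bm k_n\in\mathbb{R}^8$. The 4-stage Lobatto IIIC method has $$A=\begin{bmatrix}1/12&-\sqrt5/12&\sqrt5/12&-1/12\\1/12&1/4&(10-7\sqrt5)/60&\sqrt5/60\\1/12&(10+7\sqrt5)/60&1/4&-\sqrt5/60\\1/12&5/12&5/12&1/12\end{bmatrix},$$ $\bm b=(1/12,5/12,5/12,1/12)$, $\bm c=(0,\frac12-\frac{\sqrt5}{10},\frac12+\frac{\sqrt5}{10},1)$. DG1 scheme: with $t_n=n\Delta t$, $I_n=(t_{n-1},t_n]$, let $\psi_{n,1},\dots,\psi_{n,4}$ be the Lagrange basis of $\mathbb{P}^3(I_n)$ at the nodes $t_{n-1}+c_i\Delta t$, $i=1,\dots,4$ (the mapped Gauss–Legendre–Lobatto nodes); $N^0_{ij}=-\psi_{n,j}(t_n)\psi_{n+1,i}(t_n)$, $N^1_{ij}=\int_{I_{n+1}}\dot\psi_{n+1,j}\psi_{n+1,i}$, $N^2_{ij}=\int_{I_{n+1}}\psi_{n+1,j}\psi_{n+1,i}$, $N^3_{ij}=\psi_{n+1,j}(t_n)\psi_{n+1,i}(t_n)$, where the integrals are computed with the 4-point Gauss–Legendre–Lobatto quadrature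 (reference nodes $\{-1,-1/\sqrt5,1/\sqrt5,1\}$, weights $\{1/6,5/6,5/6,1/6\}$ on $[-1,1]$); $N^4=(N^1+N^3)^{-1}N^2$, $N^5=(N^1+N^3)^{-1}N^0$ (superscripts are labels). Explicitly $$N^4=\Delta t\,A=\Delta t\begin{bmatrix}1/12&-\sqrt5/12&\sqrt5/12&-1/12\\1/12&1/4&(10-7\sqrt5)/60&\sqrt5/60\\1/12&(10+7\sqrt5)/60&1/4&-\sqrt5/60\\1/12&5/12&5/12&1/12\end{bmatrix},$$ and $N^5\in\mathbb{R}^{4\times4}$ has last column with all entries $-1$ and all other entries $0$. *)

theory Defs
  imports Complex_Main "HOL-Computational_Algebra.Polynomial"
    "Jordan_Normal_Form.Gauss_Jordan_Elimination"
begin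

(* All vector, matrix, stage and node indices start at 0. *)

definition kron :: "'a::semiring_0 mat \<Rightarrow> 'a mat \<Rightarrow> 'a mat" where
  "kron A B = mat (dim_row A * dim_row B) (dim_col A * dim_col B)
     (\<lambda>(i, j). A $$ (i div dim_row B, j div dim_col B) * B $$ (i mod dim_row B, j mod dim_col B))"

(* Unspecified if A is singular. *)
definition mat_inv :: "'a::field mat \<Rightarrow> 'a mat" where
  "mat_inv A = the (mat_inverse A)"

definition rk_step ::
  "real mat \<Rightarrow> real vec \<Rightarrow> real mat \<Rightarrow> real \<Rightarrow> real vec \<Rightarrow> (nat \<Rightarrow> real vec) \<Rightarrow> real vec \<Rightarrow> bool" where
  "rk_step A b L \<Delta>t z k z' \<longleftrightarrow>
     (let s = dim_vec b; d = dim_row L in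
       (\<forall>i<s. k i \<in> carrier_vec d \<and>
          k i = L *\<^sub>v (z + \<Delta>t \<cdot>\<^sub>v finsum_vec TYPE(real) d (\<lambda>j. A $$ (i, j) \<cdot>\<^sub>v k j) {..<s})) \<and>
       z' = z + \<Delta>t \<cdot>\<^sub>v finsum_vec TYPE(real) d (\<lambda>i. b $ i \<cdot>\<^sub>v k i) {..<s})"

definition lobatto_A :: "real mat" where
  "lobatto_A = mat_of_rows_list 4
    [[1/12, - sqrt 5 / 12, sqrt 5 / 12, - 1/12],
     [1/12, 1/4, (10 - 7 * sqrt 5) / 60, sqrt 5 / 60],
     [1/12, (10 + 7 * sqrt 5) / 60, 1/4, - sqrt 5 / 60],
     [1/12, 5/12, 5/12, 1/12]]"

definition lobatto_b :: "real vec" where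
  "lobatto_b = vec_of_list [1/12, 5/12, 5/12, 1/12]"

definition lobatto_c :: "real vec" where
  "lobatto_c = vec_of_list [0, 1/2 - sqrt 5 / 10, 1/2 + sqrt 5 / 10, 1]"

definition stack4 :: "(nat \<Rightarrow> real vec) \<Rightarrow> real vec" where
  "stack4 k = k 0 @\<^sub>v k 1 @\<^sub>v k 2 @\<^sub>v k 3"

definition comps78 :: "real vec \<Rightarrow> real vec" where
  "comps78 x = vec_of_list [x $ 6, x $ 7]"

(* Indices are integers because the first step uses the basis on the formal interval
   I_0 = (-h, 0], h being the step size. *)

definition dg_time :: "real \<Rightarrow> int \<Rightarrow> real" where
  "dg_time \<Delta>t n = of_int n * \<Delta>t"

definition lagrange_basis :: "nat \<Rightarrow> (nat \<Rightarrow> real) \<Rightarrow> nat \<Rightarrow> real poly" where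
  "lagrange_basis s x i = (\<Prod>m\<in>{..<s} - {i}. Polynomial.smult (1 / (x i - x m)) [:- x m, 1:])"

definition dg_basis :: "real \<Rightarrow> int \<Rightarrow> nat \<Rightarrow> real poly" where
  "dg_basis \<Delta>t n = lagrange_basis 4 (\<lambda>i. dg_time \<Delta>t (n - 1) + lobatto_c $ i * \<Delta>t)"

definition gll_node :: "real vec" where
  "gll_node = vec_of_list [- 1, - 1 / sqrt 5, 1 / sqrt 5, 1]"

definition gll_weight :: "real vec" where
  "gll_weight = vec_of_list [1/6, 5/6, 5/6, 1/6]"

definition gll_quad :: "real \<Rightarrow> real \<Rightarrow> (real \<Rightarrow> real) \<Rightarrow> real" where
  "gll_quad a b f =
     (b - a) / 2 * (\<Sum>q<4. gll_weight $ q * f ((a + b) / 2 + (b - a) / 2 * gll_node $ q))"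

(* dg_N0, ..., dg_N5 at index n are the matrices used in the step from time n to n + 1. *)

definition dg_N0 :: "real \<Rightarrow> int \<Rightarrow> real mat" where
  "dg_N0 \<Delta>t n = mat 4 4 (\<lambda>(i, j).
     - (poly (dg_basis \<Delta>t n j) (dg_time \<Delta>t n) * poly (dg_basis \<Delta>t (n + 1) i) (dg_time \<Delta>t n)))"

definition dg_N1 :: "real \<Rightarrow> int \<Rightarrow> real mat" where
  "dg_N1 \<Delta>t n = mat 4 4 (\<lambda>(i, j).
     gll_quad (dg_time \<Delta>t n) (dg_time \<Delta>t (n + 1))
       (\<lambda>t. poly (pderiv (dg_basis \<Delta>t (n + 1) j)) t * poly (dg_basis \<Delta>t (n + 1) i) t))"

definition dg_N2 :: "real \<Rightarrow> int \<Rightarrow> real mat" where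
  "dg_N2 \<Delta>t n = mat 4 4 (\<lambda>(i, j).
     gll_quad (dg_time \<Delta>t n) (dg_time \<Delta>t (n + 1))
       (\<lambda>t. poly (dg_basis \<Delta>t (n + 1) j) t * poly (dg_basis \<Delta>t (n + 1) i) t))"

definition dg_N3 :: "real \<Rightarrow> int \<Rightarrow> real mat" where
  "dg_N3 \<Delta>t n = mat 4 4 (\<lambda>(i, j).
     poly (dg_basis \<Delta>t (n + 1) j) (dg_time \<Delta>t n) * poly (dg_basis \<Delta>t (n + 1) i) (dg_time \<Delta>t n))"

definition dg_N4 :: "real \<Rightarrow> int \<Rightarrow> real mat" where
  "dg_N4 \<Delta>t n = mat_inv (dg_N1 \<Delta>t n + dg_N3 \<Delta>t n) * dg_N2 \<Delta>t n"

definition dg_N5 :: "real \<Rightarrow> int \<Rightarrow> real mat" where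
  "dg_N5 \<Delta>t n = mat_inv (dg_N1 \<Delta>t n + dg_N3 \<Delta>t n) * dg_N0 \<Delta>t n"

definition dg_step :: "real mat \<Rightarrow> real \<Rightarrow> int \<Rightarrow> real vec \<Rightarrow> real vec \<Rightarrow> bool" where
  "dg_step L \<Delta>t n x x' \<longleftrightarrow>
     (kron (1\<^sub>m 4) (1\<^sub>m 2) - kron (dg_N4 \<Delta>t n) L) *\<^sub>v x' = (- kron (dg_N5 \<Delta>t n) (1\<^sub>m 2)) *\<^sub>v x"

end

theory Submission
  imports Defs "Jordan_Normal_Form.Determinant"
begin

text \<open>Both schemes solve the same linear system for the same unknowns, and that system has only one
solution.

Write \<open>A\<close>, \<open>b\<close>, \<open>c\<close> for the Lobatto tableau, \<open>B = diag b\<close>, \<open>h\<close> for the step size and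
\<open>e\<^sub>0, \<dots>, e\<^sub>3\<close> for the unit vectors. The quadrature nodes are the interpolation nodes, so
\<open>N2 = h B\<close> and \<open>N0 = - e\<^sub>0 e\<^sub>3\<^sup>T\<close>, while \<open>N1 + N3 = B D + e\<^sub>0 e\<^sub>0\<^sup>T\<close>, where \<open>D\<close> differentiates
cubics given by their values at the nodes \<open>c\<close>. No entry of \<open>D\<close> has to be computed: row \<open>i\<close>
of \<open>A\<close> integrates the derivative of a cubic exactly over \<open>[0, c\<^sub>i]\<close>
(\<open>lobatto_A_simplifying_condition\<close>), and as the first column of \<open>A\<close> is constantly \<open>b\<^sub>0\<close>, this
says precisely that \<open>A B\<^sup>-\<^sup>1\<close> is inverse to \<open>B D + e\<^sub>0 e\<^sub>0\<^sup>T\<close> (\<open>mat_inv_dg_N1_N3\<close>). Hence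
\<open>N4 = h A\<close>, and \<open>N5\<close> replaces every block of a vector by minus the last block. One DG step from
\<open>x\<close> thus says that the four blocks \<open>u\<^sub>i\<close> of \<open>x'\<close> satisfy \<open>u\<^sub>i = [x]\<^sub>7\<^sub>8 + h (\<Sum>j. a\<^sub>i\<^sub>j L u\<^sub>j)\<close>
(\<open>dg_step_stages\<close>).

The Runge-Kutta stages are \<open>k\<^sub>i = L y\<^sub>i\<close> with \<open>y\<^sub>i = z + h (\<Sum>j. a\<^sub>i\<^sub>j L y\<^sub>j)\<close>, which is the same system
when \<open>[x]\<^sub>7\<^sub>8 = z\<close>. The last row of \<open>A\<close> is \<open>b\<close>, so \<open>y\<^sub>3\<close> is the new Runge-Kutta value, as the last
block of \<open>x'\<close> is the new DG value (\<open>rk_step_stages\<close>).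

The system is uniquely solvable (\<open>oscillator_stages_unique\<close>) by an energy argument. Let \<open>u\<close> solve
the homogeneous system, so \<open>u = A w\<close> with \<open>w\<^sub>j = h L u\<^sub>j\<close>. As \<open>L\<close> is skew for the inner product
\<open>lam p p' + q q'\<close>, every \<open>u\<^sub>i\<close> is orthogonal to \<open>w\<^sub>i\<close>; but the sum of these products, weighted
by \<open>b\<close>, is half the sum of the squared norms of \<open>u\<^sub>0\<close> and \<open>u\<^sub>3\<close>
(\<open>lobatto_energy_identity\<close>). So these two blocks vanish, and then the other two vanish as well.

The theorem follows by
induction on the number of steps.\<close>

section \<open>The Lobatto tableau\<close>

lemma sum_lessThan_4: "(\<Sum>j<4. f j) = f 0 + f 1 + f 2 + f (3::nat)"
  by (simp add: eval_nat_numeral)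

lemma less_4_cases: "(i::nat) < 4 \<Longrightarrow> i = 0 \<or> i = 1 \<or> i = 2 \<or> i = 3"
  by linarith

lemma lobatto_A_carrier: "lobatto_A \<in> carrier_mat 4 4"
  by (rule carrier_matI) (simp_all add: lobatto_A_def mat_of_rows_list_def)

lemma lobatto_A_entries:
  "lobatto_A $$ (0, 0) = 1/12" "lobatto_A $$ (0, 1) = - sqrt 5 / 12"
  "lobatto_A $$ (0, 2) = sqrt 5 / 12" "lobatto_A $$ (0, 3) = - 1/12"
  "lobatto_A $$ (1, 0) = 1/12" "lobatto_A $$ (1, 1) = 1/4"
  "lobatto_A $$ (1, 2) = (10 - 7 * sqrt 5) / 60" "lobatto_A $$ (1, 3) = sqrt 5 / 60"
  "lobatto_A $$ (2, 0) = 1/12" "lobatto_A $$ (2, 1) = (10 + 7 * sqrt 5) / 60"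
  "lobatto_A $$ (2, 2) = 1/4" "lobatto_A $$ (2, 3) = - sqrt 5 / 60"
  "lobatto_A $$ (3, 0) = 1/12" "lobatto_A $$ (3, 1) = 5/12"
  "lobatto_A $$ (3, 2) = 5/12" "lobatto_A $$ (3, 3) = 1/12"
  by (simp_all add: lobatto_A_def mat_of_rows_list_def eval_nat_numeral)

lemma lobatto_b_entries:
  "lobatto_b $ 0 = 1/12" "lobatto_b $ 1 = 5/12" "lobatto_b $ 2 = 5/12" "lobatto_b $ 3 = 1/12"
  by (simp_all add: lobatto_b_def vec_of_list_index eval_nat_numeral)

lemma lobatto_c_entries:
  "lobatto_c $ 0 = 0" "lobatto_c $ 1 = 1/2 - sqrt 5 / 10"
  "lobatto_c $ 2 = 1/2 + sqrt 5 / 10" "lobatto_c $ 3 = 1"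
  by (simp_all add: lobatto_c_def vec_of_list_index eval_nat_numeral)

lemmas lobatto_entries = lobatto_A_entries lobatto_b_entries lobatto_c_entries

lemma lobatto_b_nonzero: "i < 4 \<Longrightarrow> lobatto_b $ i \<noteq> 0"
  using less_4_cases[of i] by (auto simp: lobatto_entries simp del: One_nat_def)

lemma lobatto_A_first_column: "i < 4 \<Longrightarrow> lobatto_A $$ (i, 0) = lobatto_b $ 0"
  using less_4_cases[of i] by (auto simp: lobatto_entries simp del: One_nat_def)

lemma lobatto_A_last_row: "j < 4 \<Longrightarrow> lobatto_A $$ (3, j) = lobatto_b $ j"
  using less_4_cases[of j] by (auto simp: lobatto_entries simp del: One_nat_def)

lemma inj_on_lobatto_c: "inj_on (\<lambda>i. lobatto_c $ i) {..<4}"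
proof (rule inj_onI)
  fix i j :: nat assume "i \<in> {..<4}" "j \<in> {..<4}" and eq: "lobatto_c $ i = lobatto_c $ j"
  then have ij: "i < 4" "j < 4" by auto
  have s: "sqrt 5 > (0::real)" "sqrt 5 < 5" by (simp_all add: real_less_lsqrt)
  show "i = j"
    using less_4_cases[OF ij(1)] less_4_cases[OF ij(2)] eq s
    by (elim disjE) (simp_all add: lobatto_entries del: One_nat_def)
qed

text \<open>Row \<open>i\<close> of \<open>A\<close> is a quadrature rule for \<open>[0, c\<^sub>i]\<close> that is exact up to degree 2 (the
simplifying condition called \<open>C(3)\<close> in the Runge-Kutta literature). Both sides are linear in \<open>p\<close>,
so this amounts to \<open>(\<Sum>j. a\<^sub>i\<^sub>j c\<^sub>j\<^sup>q) = c\<^sub>i\<^sup>q\<^sup>+\<^sup>1 / (q + 1)\<close> for \<open>q = 0, 1, 2\<close>.\<close>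

lemma lobatto_A_simplifying_condition:
  fixes p :: "real poly"
  assumes "degree p \<le> 3" and "i < 4"
  shows "(\<Sum>j<4. lobatto_A $$ (i, j) * poly (pderiv p) (lobatto_c $ j)) =
    poly p (lobatto_c $ i) - poly p 0"
proof -
  obtain a0 a1 a2 a3 where p: "p = [:a0, a1, a2, a3:]"
  proof -
    have "p = [:coeff p 0, coeff p 1, coeff p 2, coeff p 3:]"
    proof (rule poly_eqI)
      fix n
      show "coeff p n = coeff [:coeff p 0, coeff p 1, coeff p 2, coeff p 3:] n"
      proof (cases "n < 4")
        case True
        then show ?thesis using less_4_cases[of n]
          by (auto simp: eval_nat_numeral)
      next
        case False
        obtain m where "n = Suc (Suc (Suc (Suc m)))"
          using False by (intro that[of "n - 4"]) simp
        moreover have "coeff p n = 0" using False assms(1) by (intro coeff_eq_0) simp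
        ultimately show ?thesis by simp
      qed
    qed
    then show ?thesis using that by blast
  qed
  have s: "sqrt 5 * (sqrt 5 * x) = 5 * x" for x :: real
    by (simp flip: mult.assoc)
  show ?thesis
    using less_4_cases[OF assms(2)]
    by (elim disjE) (simp_all add: p sum_lessThan_4 lobatto_entries pderiv_pCons
        field_simps s del: One_nat_def)
qed

text \<open>Let \<open>U\<close> be the cubic with \<open>U(c\<^sub>i) = u\<^sub>i\<close>. Inverting \<open>u = A w\<close> by the simplifying condition gives
\<open>w\<^sub>i = U'(c\<^sub>i)\<close> for \<open>i > 0\<close> and \<open>w\<^sub>0 = U'(0) + U(0) / b\<^sub>0\<close>. The Lobatto rule integrates \<open>U U'\<close>, of
degree 5, exactly, so the sum is \<open>(U(1)\<^sup>2 - U(0)\<^sup>2) / 2 + U(0)\<^sup>2\<close>. The proof checks the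
resulting identity of quadratic forms in \<open>w\<close> by expansion.\<close>

lemma lobatto_energy_identity:
  fixes w u :: "nat \<Rightarrow> real"
  assumes "\<And>i. i < 4 \<Longrightarrow> u i = (\<Sum>j<4. lobatto_A $$ (i, j) * w j)"
  shows "(\<Sum>i<4. lobatto_b $ i * u i * w i) = ((u 0)\<^sup>2 + (u 3)\<^sup>2) / 2"
proof -
  have s: "sqrt 5 * (sqrt 5 * x) = 5 * x" for x :: real
    by (simp flip: mult.assoc)
  show ?thesis
    by (simp add: assms sum_lessThan_4 lobatto_entries power2_eq_square field_simps s
        del: One_nat_def)
qed

text \<open>With \<open>w\<^sub>0 = w\<^sub>3 = 0\<close>, the first row of \<open>A\<close> sees only \<open>w\<^sub>2 - w\<^sub>1\<close> and the last one only \<open>w\<^sub>1 + w\<^sub>2\<close>.\<close>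

lemma lobatto_A_endpoint_injective:
  fixes w :: "nat \<Rightarrow> real"
  assumes "w 0 = 0" "w 3 = 0"
    and "(\<Sum>j<4. lobatto_A $$ (0, j) * w j) = 0"
    and "(\<Sum>j<4. lobatto_A $$ (3, j) * w j) = 0"
    and "i < 4"
  shows "w i = 0"
proof -
  have "w 2 = w 1" "w 1 + w 2 = 0"
    using assms(1-4) by (simp_all add: sum_lessThan_4 lobatto_entries del: One_nat_def)
  then have "w 1 = 0" "w 2 = 0" by linarith+
  then show ?thesis using less_4_cases[OF \<open>i < 4\<close>] assms(1,2) by auto
qed

section \<open>Unique solvability of the stage equations\<close>

text \<open>Apply the energy identity to \<open>p = A (h q)\<close> and to \<open>q = A (- h lam p)\<close>. The left-hand sides differ
by the factor \<open>- lam\<close>, so \<open>lam\<close> times the first plus the second makes a sum of squares vanish that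
contains the end components of \<open>p\<close> and \<open>q\<close>.\<close>

lemma oscillator_stages_zero:
  fixes p q :: "nat \<Rightarrow> real"
  assumes lam: "lam > 0" and h: "h \<noteq> 0"
    and p: "\<And>i. i < 4 \<Longrightarrow> p i = h * (\<Sum>j<4. lobatto_A $$ (i, j) * q j)"
    and q: "\<And>i. i < 4 \<Longrightarrow> q i = - h * lam * (\<Sum>j<4. lobatto_A $$ (i, j) * p j)"
    and i: "i < 4"
  shows "p i = 0 \<and> q i = 0"
proof -
  define S where "S = h * (\<Sum>i<4. lobatto_b $ i * p i * q i)"
  have "(\<Sum>i<4. lobatto_b $ i * p i * (h * q i)) = ((p 0)\<^sup>2 + (p 3)\<^sup>2) / 2"
    by (rule lobatto_energy_identity) (simp add: p sum_distrib_left mult_ac)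
  moreover have "(\<Sum>i<4. lobatto_b $ i * p i * (h * q i)) = S"
    by (simp add: S_def sum_distrib_left mult_ac)
  ultimately have P: "(p 0)\<^sup>2 + (p 3)\<^sup>2 = 2 * S"
    by simp
  have "(\<Sum>i<4. lobatto_b $ i * q i * (- h * lam * p i)) = ((q 0)\<^sup>2 + (q 3)\<^sup>2) / 2"
    by (rule lobatto_energy_identity) (simp add: q sum_distrib_left mult_ac sum_negf)
  moreover have "(\<Sum>i<4. lobatto_b $ i * q i * (- h * lam * p i)) = - lam * S"
    by (simp add: S_def sum_distrib_left mult_ac sum_negf)
  ultimately have Q: "(q 0)\<^sup>2 + (q 3)\<^sup>2 = - 2 * lam * S"
    by simp
  have "lam * ((p 0)\<^sup>2 + (p 3)\<^sup>2) + ((q 0)\<^sup>2 + (q 3)\<^sup>2) = 0"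
    unfolding P Q by simp
  moreover have "0 \<le> lam * ((p 0)\<^sup>2 + (p 3)\<^sup>2)" "0 \<le> (q 0)\<^sup>2 + (q 3)\<^sup>2"
    using lam by simp_all
  ultimately have "lam * ((p 0)\<^sup>2 + (p 3)\<^sup>2) = 0" "(q 0)\<^sup>2 + (q 3)\<^sup>2 = 0"
    by linarith+
  then have ends: "p 0 = 0" "p 3 = 0" "q 0 = 0" "q 3 = 0"
    using lam by (simp_all add: sum_power2_eq_zero_iff)
  have "q i = 0"
    using lobatto_A_endpoint_injective[of q i] ends p[of 0] p[of 3] h i by simp
  moreover have "p i = 0"
    using lobatto_A_endpoint_injective[of p i] ends q[of 0] q[of 3] h lam i by simp
  ultimately show ?thesis by simp
qed

lemma oscillator_stages_unique:
  fixes p q p' q' :: "nat \<Rightarrow> real"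
  assumes lam: "lam > 0" and h: "h \<noteq> 0"
    and p: "\<And>i. i < 4 \<Longrightarrow> p i = \<alpha> + h * (\<Sum>j<4. lobatto_A $$ (i, j) * q j)"
    and q: "\<And>i. i < 4 \<Longrightarrow> q i = \<beta> - h * lam * (\<Sum>j<4. lobatto_A $$ (i, j) * p j)"
    and p': "\<And>i. i < 4 \<Longrightarrow> p' i = \<alpha> + h * (\<Sum>j<4. lobatto_A $$ (i, j) * q' j)"
    and q': "\<And>i. i < 4 \<Longrightarrow> q' i = \<beta> - h * lam * (\<Sum>j<4. lobatto_A $$ (i, j) * p' j)"
    and i: "i < 4"
  shows "p i = p' i \<and> q i = q' i"
proof -
  have "p i - p' i = 0 \<and> q i - q' i = 0"
  proof (rule oscillator_stages_zero[OF lam h _ _ i])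
    fix i :: nat assume i: "i < 4"
    show "p i - p' i = h * (\<Sum>j<4. lobatto_A $$ (i, j) * (q j - q' j))"
      unfolding p[OF i] p'[OF i] by (simp add: right_diff_distrib sum_subtractf)
    show "q i - q' i = - h * lam * (\<Sum>j<4. lobatto_A $$ (i, j) * (p j - p' j))"
      unfolding q[OF i] q'[OF i] by (simp add: right_diff_distrib sum_subtractf)
  qed
  then show ?thesis by simp
qed

section \<open>Lagrange bases and inverse matrices\<close>

lemma degree_lagrange_basis_le:
  assumes "i < s"
  shows "degree (lagrange_basis s x i) \<le> s - 1"
proof -
  have "degree (lagrange_basis s x i) \<le>
      (\<Sum>m\<in>{..<s} - {i}. degree (Polynomial.smult (1 / (x i - x m)) [:- x m, 1:]))"
    unfolding lagrange_basis_def
    using degree_prod_sum_le[of "{..<s} - {i}"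
        "\<lambda>m. Polynomial.smult (1 / (x i - x m)) [:- x m, 1:]"]
    by (simp add: o_def)
  also have "\<dots> \<le> (\<Sum>m\<in>{..<s} - {i}. 1)"
    by (rule sum_mono) simp
  also have "\<dots> = s - 1"
    using assms by simp
  finally show ?thesis .
qed

lemma poly_lagrange_basis_node:
  assumes "inj_on x {..<s}" "i < s" "j < s"
  shows "poly (lagrange_basis s x i) (x j) = (if i = j then 1 else 0)"
proof (cases "i = j")
  case True
  have "x m \<noteq> x i" if "m \<in> {..<s} - {i}" for m
    using that assms by (auto dest: inj_onD)
  then have "(\<Prod>m\<in>{..<s} - {i}. (x i - x m) / (x i - x m)) = 1"
    by (intro prod.neutral) force
  then show ?thesis using True
    by (simp add: lagrange_basis_def poly_prod flip: diff_divide_distrib)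
next
  case False
  then show ?thesis using assms
    by (auto simp: lagrange_basis_def poly_prod)
qed

lemma mat_inv_eqI:
  fixes A B :: "'a::field mat"
  assumes A: "A \<in> carrier_mat n n" and B: "B \<in> carrier_mat n n" and BA: "B * A = 1\<^sub>m n"
  shows "mat_inv A = B"
proof (cases "mat_inverse A")
  case None
  have "A * B = 1\<^sub>m n"
    using mat_mult_left_right_inverse[OF B A BA] .
  then have "A \<in> Units (ring_mat TYPE('a) n ())"
    using A B BA by (auto simp: Units_def ring_mat_def)
  then show ?thesis using mat_inverse(1)[OF A None, of "()"] by blast
next
  case (Some C)
  then have C: "A * C = 1\<^sub>m n" "C \<in> carrier_mat n n"
    using mat_inverse(2)[OF A Some] by auto
  have "B = B * (A * C)" using B C by simp
  also have "\<dots> = B * A * C" using A B C by (metis assoc_mult_mat)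
  also have "\<dots> = C" using BA C by simp
  finally show ?thesis using Some by (simp add: mat_inv_def)
qed

section \<open>The matrices of the DG scheme\<close>

lemma dg_time_add_one: "dg_time h (n + 1) = dg_time h n + h"
  by (simp add: dg_time_def algebra_simps)

text \<open>The quadrature rule moved from \<open>[-1, 1]\<close> to \<open>[0, 1]\<close> has nodes \<open>c\<close> and weights \<open>b\<close>, because
\<open>1 / sqrt 5 = sqrt 5 / 5\<close>.\<close>

lemma gll_quad_lobatto:
  "gll_quad a (a + h) f = h * (\<Sum>q<4. lobatto_b $ q * f (a + lobatto_c $ q * h))"
proof -
  have inv: "1 / sqrt 5 = sqrt 5 / (5::real)"
    by (simp add: field_simps)
  have w: "gll_weight $ q = 2 * lobatto_b $ q" if "q < 4" for q
    using less_4_cases[OF that]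
    by (auto simp: gll_weight_def lobatto_b_def vec_of_list_index eval_nat_numeral)
  have x: "(a + (a + h)) / 2 + (a + h - a) / 2 * gll_node $ q = a + lobatto_c $ q * h"
    if "q < 4" for q
    using less_4_cases[OF that] inv
    by (elim disjE) (simp_all add: gll_node_def lobatto_c_def vec_of_list_index eval_nat_numeral
        field_simps)
  show ?thesis
    unfolding gll_quad_def sum_distrib_left
    by (intro sum.cong refl) (simp only: x w lessThan_iff, simp)
qed

lemma dg_basis_node:
  assumes "h \<noteq> 0" "i < 4" "j < 4"
  shows "poly (dg_basis h (n + 1) i) (dg_time h n + lobatto_c $ j * h) = (if i = j then 1 else 0)"
proof -
  have "inj_on (\<lambda>i. dg_time h n + lobatto_c $ i * h) {..<4}"
    using inj_on_lobatto_c assms(1) by (simp add: inj_on_def)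
  from poly_lagrange_basis_node[OF this assms(2,3)]
  show ?thesis by (simp add: dg_basis_def)
qed

lemma dg_basis_left:
  assumes "h \<noteq> 0" "i < 4"
  shows "poly (dg_basis h (n + 1) i) (dg_time h n) = (if i = 0 then 1 else 0)"
  using dg_basis_node[OF assms, of 0 n] by (simp add: lobatto_entries)

lemma dg_basis_right:
  assumes "h \<noteq> 0" "i < 4"
  shows "poly (dg_basis h n i) (dg_time h n) = (if i = 3 then 1 else 0)"
  using dg_basis_node[OF assms, of 3 "n - 1"] dg_time_add_one[of h "n - 1"]
  by (simp add: lobatto_entries)

text \<open>The quadrature nodes are the interpolation nodes, so integrating against a basis function is point
evaluation.\<close>

lemma dg_quad_basis:
  assumes "h \<noteq> 0" "i < 4"
  shows "gll_quad (dg_time h n) (dg_time h (n + 1))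
      (\<lambda>t. f t * poly (dg_basis h (n + 1) i) t) =
    h * lobatto_b $ i * f (dg_time h n + lobatto_c $ i * h)"
proof -
  have "(\<Sum>q<4. lobatto_b $ q * (f (dg_time h n + lobatto_c $ q * h) *
        poly (dg_basis h (n + 1) i) (dg_time h n + lobatto_c $ q * h))) =
      (\<Sum>q<4. if i = q then lobatto_b $ q * f (dg_time h n + lobatto_c $ q * h) else 0)"
    using assms by (intro sum.cong) (auto simp: dg_basis_node)
  then show ?thesis
    using assms by (simp add: dg_time_add_one gll_quad_lobatto)
qed

lemma dg_N1_entry:
  assumes "h \<noteq> 0" "i < 4" "j < 4"
  shows "dg_N1 h n $$ (i, j) = h * lobatto_b $ i *
    poly (pderiv (dg_basis h (n + 1) j)) (dg_time h n + lobatto_c $ i * h)"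
  using assms by (simp add: dg_N1_def dg_quad_basis)

lemma dg_N2_entry:
  assumes "h \<noteq> 0" "i < 4" "j < 4"
  shows "dg_N2 h n $$ (i, j) = (if i = j then h * lobatto_b $ i else 0)"
  using assms by (auto simp: dg_N2_def dg_quad_basis dg_basis_node)

lemma dg_N3_entry:
  assumes "h \<noteq> 0" "i < 4" "j < 4"
  shows "dg_N3 h n $$ (i, j) = (if i = 0 \<and> j = 0 then 1 else 0)"
  using assms by (simp add: dg_N3_def dg_basis_left)

lemma dg_N0_entry:
  assumes "h \<noteq> 0" "i < 4" "j < 4"
  shows "dg_N0 h n $$ (i, j) = (if i = 0 \<and> j = 3 then - 1 else 0)"
  using assms by (simp add: dg_N0_def dg_basis_left dg_basis_right)

text \<open>In the rescaled time \<open>\<tau> \<in> [0, 1]\<close> a basis function is a cubic in \<open>\<tau>\<close>, to which the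
simplifying condition applies; \<open>h\<close> comes from the chain rule.\<close>

lemma dg_basis_simplifying_condition:
  assumes "h \<noteq> 0" "i < 4" "j < 4"
  shows "(\<Sum>k<4. lobatto_A $$ (i, k) *
      (h * poly (pderiv (dg_basis h (n + 1) j)) (dg_time h n + lobatto_c $ k * h))) =
    (if i = j then 1 else 0) - (if j = 0 then 1 else 0)"
proof -
  let ?\<psi> = "dg_basis h (n + 1) j"
  let ?p = "pcompose ?\<psi> [:dg_time h n, h:]"
  have "degree ?\<psi> \<le> 3"
    using degree_lagrange_basis_le[OF assms(3)] by (simp add: dg_basis_def)
  then have "degree ?p \<le> 3"
    using assms(1) by (simp add: degree_pcompose)
  from lobatto_A_simplifying_condition[OF this assms(2)]
  have "(\<Sum>k<4. lobatto_A $$ (i, k) * poly (pderiv ?p) (lobatto_c $ k)) =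
      poly ?\<psi> (dg_time h n + lobatto_c $ i * h) - poly ?\<psi> (dg_time h n)"
    by (simp add: poly_pcompose mult.commute)
  moreover have "poly (pderiv ?p) \<tau> = h * poly (pderiv ?\<psi>) (dg_time h n + \<tau> * h)" for \<tau>
    by (simp add: pderiv_pcompose poly_pcompose pderiv_pCons mult.commute)
  ultimately show ?thesis
    using assms by (auto simp: dg_basis_node dg_basis_left)
qed

text \<open>The product \<open>A B\<^sup>-\<^sup>1\<close> with \<open>B = diag b\<close>, which turns out to be the inverse of \<open>N1 + N3\<close> for
every step size.\<close>

definition lobatto_A_diag_b_inv :: "real mat" where
  "lobatto_A_diag_b_inv = mat 4 4 (\<lambda>(i, j). lobatto_A $$ (i, j) / lobatto_b $ j)"

lemma index_mult_mat_sum: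
  assumes "A \<in> carrier_mat m r" "B \<in> carrier_mat r n" "i < m" "j < n"
  shows "(A * B) $$ (i, j) = (\<Sum>k<r. A $$ (i, k) * B $$ (k, j))"
  using assms by (auto simp: scalar_prod_def atLeast0LessThan intro!: sum.cong)

lemma dg_carrier:
  "dg_N0 h n \<in> carrier_mat 4 4" "dg_N1 h n \<in> carrier_mat 4 4"
  "dg_N2 h n \<in> carrier_mat 4 4" "dg_N3 h n \<in> carrier_mat 4 4"
  "lobatto_A_diag_b_inv \<in> carrier_mat 4 4"
  by (simp_all add: dg_N0_def dg_N1_def dg_N2_def dg_N3_def lobatto_A_diag_b_inv_def)

text \<open>In \<open>A B\<^sup>-\<^sup>1 N1\<close> the weights cancel, so column \<open>j\<close> holds the increments of the basis function \<open>j\<close>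
from the left end of the interval, by the simplifying condition. This is the identity matrix up to
\<open>- 1\<close> throughout column 0, and \<open>A B\<^sup>-\<^sup>1 N3\<close> adds back exactly this column, since \<open>a\<^sub>i\<^sub>0 = b\<^sub>0\<close>
for all \<open>i\<close>.\<close>

lemma mat_inv_dg_N1_N3:
  assumes h: "h \<noteq> 0"
  shows "mat_inv (dg_N1 h n + dg_N3 h n) = lobatto_A_diag_b_inv"
proof (rule mat_inv_eqI)
  show C: "dg_N1 h n + dg_N3 h n \<in> carrier_mat 4 4" "lobatto_A_diag_b_inv \<in> carrier_mat 4 4"
    using dg_carrier by auto
  show "lobatto_A_diag_b_inv * (dg_N1 h n + dg_N3 h n) = 1\<^sub>m 4"
  proof (rule eq_matI)
    fix i j assume "i < dim_row (1\<^sub>m 4 :: real mat)" "j < dim_col (1\<^sub>m 4 :: real mat)"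
    then have ij: "i < 4" "j < 4" by simp_all
    let ?d = "\<lambda>k. lobatto_A $$ (i, k) *
      (h * poly (pderiv (dg_basis h (n + 1) j)) (dg_time h n + lobatto_c $ k * h))"
    have "(lobatto_A_diag_b_inv * (dg_N1 h n + dg_N3 h n)) $$ (i, j) =
        (\<Sum>k<4. lobatto_A_diag_b_inv $$ (i, k) * (dg_N1 h n + dg_N3 h n) $$ (k, j))"
      using index_mult_mat_sum[OF C(2,1) ij] .
    also have "\<dots> = (\<Sum>k<4. ?d k + (if k = 0 then if j = 0 then 1 else 0 else 0))"
    proof (rule sum.cong)
      fix k :: nat assume "k \<in> {..<4}"
      then have k: "k < 4" by simp
      have "(dg_N1 h n + dg_N3 h n) $$ (k, j) = dg_N1 h n $$ (k, j) + dg_N3 h n $$ (k, j)"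
        using dg_carrier(4)[of h n] k ij by (intro index_add_mat) auto
      then show "lobatto_A_diag_b_inv $$ (i, k) * (dg_N1 h n + dg_N3 h n) $$ (k, j) =
          ?d k + (if k = 0 then if j = 0 then 1 else 0 else 0)"
        using k ij h lobatto_b_nonzero[OF k] lobatto_A_first_column[OF ij(1)]
        by (simp add: lobatto_A_diag_b_inv_def dg_N1_entry dg_N3_entry field_simps)
    qed simp
    also have "\<dots> = (if i = j then 1 else 0)"
      using dg_basis_simplifying_condition[OF h ij, of n] by (simp add: sum.distrib)
    finally show "(lobatto_A_diag_b_inv * (dg_N1 h n + dg_N3 h n)) $$ (i, j) = 1\<^sub>m 4 $$ (i, j)"
      using ij by simp
  qed (use C in auto)
qed

lemma dg_N4_eq:
  assumes h: "h \<noteq> 0"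
  shows "dg_N4 h n = h \<cdot>\<^sub>m lobatto_A"
proof (rule eq_matI)
  fix i j assume "i < dim_row (h \<cdot>\<^sub>m lobatto_A)" "j < dim_col (h \<cdot>\<^sub>m lobatto_A)"
  then have ij: "i < 4" "j < 4" using lobatto_A_carrier by auto
  have "dg_N4 h n $$ (i, j) = (\<Sum>k<4. lobatto_A_diag_b_inv $$ (i, k) * dg_N2 h n $$ (k, j))"
    unfolding dg_N4_def mat_inv_dg_N1_N3[OF h] by (rule index_mult_mat_sum) (use ij dg_carrier in auto)
  also have "\<dots> = (\<Sum>k<4. if k = j then h * lobatto_A $$ (i, j) else 0)"
    using ij h lobatto_b_nonzero by (intro sum.cong) (auto simp: lobatto_A_diag_b_inv_def dg_N2_entry)
  finally show "dg_N4 h n $$ (i, j) = (h \<cdot>\<^sub>m lobatto_A) $$ (i, j)"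
    using ij lobatto_A_carrier by simp
qed (use lobatto_A_carrier dg_carrier(3)[of h n] dg_carrier(5) in
    \<open>auto simp: dg_N4_def mat_inv_dg_N1_N3[OF h]\<close>)

lemma dg_N5_eq:
  assumes h: "h \<noteq> 0"
  shows "dg_N5 h n = mat 4 4 (\<lambda>(i, j). if j = 3 then - 1 else 0)"
proof (rule eq_matI)
  fix i j assume "i < dim_row (mat 4 4 (\<lambda>(i, j). if j = 3 then - 1 else 0 :: real))"
    "j < dim_col (mat 4 4 (\<lambda>(i, j). if j = 3 then - 1 else 0 :: real))"
  then have ij: "i < 4" "j < 4" by auto
  have "dg_N5 h n $$ (i, j) = (\<Sum>k<4. lobatto_A_diag_b_inv $$ (i, k) * dg_N0 h n $$ (k, j))"
    unfolding dg_N5_def mat_inv_dg_N1_N3[OF h] by (rule index_mult_mat_sum) (use ij dg_carrier in auto)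
  also have "\<dots> = (\<Sum>k<4::nat. if k = 0 then if j = 3 then - 1 else 0 else 0)"
    using ij h lobatto_b_nonzero[of 0] lobatto_A_first_column[OF ij(1)]
    by (intro sum.cong) (auto simp: lobatto_A_diag_b_inv_def dg_N0_entry)
  finally show "dg_N5 h n $$ (i, j) = mat 4 4 (\<lambda>(i, j). if j = 3 then - 1 else 0) $$ (i, j)"
    using ij by simp
qed (use dg_carrier(1)[of h n] dg_carrier(5) in
    \<open>auto simp: dg_N5_def mat_inv_dg_N1_N3[OF h]\<close>)

section \<open>Kronecker products and stacked vectors\<close>

lemma kron_carrier:
  assumes "A \<in> carrier_mat m r" "B \<in> carrier_mat q s"
  shows "kron A B \<in> carrier_mat (m * q) (r * s)"
  using assms by (simp add: kron_def)

text \<open>Read \<open>x\<close> as \<open>r\<close> consecutive blocks of length \<open>s\<close>: the product applies \<open>B\<close> to each block and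
combines the results with the coefficients of \<open>A\<close>.\<close>

lemma kron_mult_vec_index:
  fixes A B :: "'a::comm_semiring_0 mat"
  assumes A: "A \<in> carrier_mat m r" and B: "B \<in> carrier_mat q s"
    and x: "x \<in> carrier_vec (r * s)" and i: "i < m" and a: "a < q"
  shows "(kron A B *\<^sub>v x) $ (i * q + a) =
    (\<Sum>j<r. A $$ (i, j) * (\<Sum>b<s. B $$ (a, b) * x $ (j * s + b)))"
proof -
  have "i * q + a < (i + 1) * q" using a by simp
  also have "\<dots> \<le> m * q" using i by (intro mult_right_mono) auto
  finally have lt: "i * q + a < m * q" .
  let ?f = "\<lambda>l. A $$ (i, l div s) * (B $$ (a, l mod s) * x $ l)"
  have "(kron A B *\<^sub>v x) $ (i * q + a) = (\<Sum>l<r * s. ?f l)"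
    using A B x lt a
    by (auto simp: kron_def scalar_prod_def atLeast0LessThan mult.assoc intro!: sum.cong)
  also have "\<dots> = (\<Sum>j<r. \<Sum>l = j * s..<j * s + s. ?f l)"
    by (rule sum.nat_group[symmetric])
  also have "\<dots> = (\<Sum>j<r. \<Sum>b<s. ?f (j * s + b))"
    by (simp add: sum.atLeastLessThan_shift_0[of _ "_ * s"] atLeast0LessThan add.commute)
  also have "\<dots> = (\<Sum>j<r. \<Sum>b<s. A $$ (i, j) * (B $$ (a, b) * x $ (j * s + b)))"
    by (intro sum.cong) auto
  finally show ?thesis by (simp add: sum_distrib_left)
qed

lemma sum_lessThan_2: "(\<Sum>b<2. f b) = f 0 + f (1::nat)"
  by (simp add: eval_nat_numeral)

lemma mat_2_carrier: "mat_of_rows_list 2 [[a, b], [c, d]] \<in> carrier_mat 2 2"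
  by (rule carrier_matI) (simp_all add: mat_of_rows_list_def)

lemma mat_2_entries:
  "mat_of_rows_list 2 [[a, b], [c, d]] $$ (0, 0) = a"
  "mat_of_rows_list 2 [[a, b], [c, d]] $$ (0, 1) = b"
  "mat_of_rows_list 2 [[a, b], [c, d]] $$ (1, 0) = c"
  "mat_of_rows_list 2 [[a, b], [c, d]] $$ (1, 1) = d"
  by (simp_all add: mat_of_rows_list_def eval_nat_numeral)

lemma mat_2_mult_vec:
  fixes a b c d :: real
  assumes "x \<in> carrier_vec 2"
  shows "(mat_of_rows_list 2 [[a, b], [c, d]] *\<^sub>v x) $ 0 = a * x $ 0 + b * x $ 1"
    and "(mat_of_rows_list 2 [[a, b], [c, d]] *\<^sub>v x) $ 1 = c * x $ 0 + d * x $ 1"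
  using assms by (simp_all add: mat_of_rows_list_def scalar_prod_def eval_nat_numeral)

lemma mat_inv_oscillator:
  fixes lam :: real
  assumes "lam \<noteq> 0"
  shows "mat_inv (mat_of_rows_list 2 [[0, 1], [- lam, 0]]) =
    mat_of_rows_list 2 [[0, - 1 / lam], [1, 0]]"
proof (rule mat_inv_eqI)
  let ?L = "mat_of_rows_list 2 [[0, 1], [- lam, 0]]"
  let ?B = "mat_of_rows_list 2 [[0, - 1 / lam], [1, 0]]"
  show C: "?L \<in> carrier_mat 2 2" "?B \<in> carrier_mat 2 2"
    by (rule mat_2_carrier)+
  show "?B * ?L = 1\<^sub>m 2"
  proof (rule eq_matI)
    fix i j assume "i < dim_row (1\<^sub>m 2 :: real mat)" "j < dim_col (1\<^sub>m 2 :: real mat)"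
    then have ij: "i < 2" "j < 2" by simp_all
    then have "i = 0 \<or> i = 1" "j = 0 \<or> j = 1" by linarith+
    then show "(?B * ?L) $$ (i, j) = 1\<^sub>m 2 $$ (i, j)"
      unfolding index_mult_mat_sum[OF C(2,1) ij] sum_lessThan_2
      using assms by (auto simp: mat_2_entries mat_2_carrier simp del: One_nat_def)
  qed (use C in auto)
qed

lemma stack4_carrier:
  assumes "\<And>i. i < 4 \<Longrightarrow> k i \<in> carrier_vec 2"
  shows "stack4 k \<in> carrier_vec 8"
proof -
  have "dim_vec (k i) = 2" if "i < 4" for i
    using assms[OF that] by simp
  then show ?thesis by (intro carrier_vecI) (simp add: stack4_def)
qed

lemma stack4_index:
  assumes "\<And>i. i < 4 \<Longrightarrow> k i \<in> carrier_vec 2" and "i < 4" "a < 2"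
  shows "stack4 k $ (i * 2 + a) = k i $ a"
proof -
  have d: "dim_vec (k i) = 2" if "i < 4" for i
    using assms(1)[OF that] by simp
  have d4: "dim_vec (k 0) = 2" "dim_vec (k 1) = 2" "dim_vec (k 2) = 2" "dim_vec (k 3) = 2"
    by (rule d; simp)+
  show ?thesis
    using less_4_cases[OF assms(2)] assms(3) d4
    by (elim disjE) (simp_all add: stack4_def del: One_nat_def)
qed

lemma eq_vec8I:
  assumes "x \<in> carrier_vec 8" "y \<in> carrier_vec 8"
    and "\<And>i. i < 4 \<Longrightarrow> x $ (i * 2) = y $ (i * 2) \<and> x $ (i * 2 + 1) = y $ (i * 2 + 1)"
  shows "x = y"
proof (rule eq_vecI)
  fix l assume "l < dim_vec y"
  then have "l div 2 < 4" using assms(2) by simp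
  from assms(3)[OF this] show "x $ l = y $ l"
    by (cases "even l") (auto elim!: evenE oddE simp: mult.commute)
qed (use assms in simp)

section \<open>One step of the two schemes\<close>

text \<open>With \<open>N4 = h A\<close> and \<open>N5\<close> known, this is the DG step written out block by block: in block \<open>i\<close> the
component \<open>i * 2\<close> is the position and \<open>i * 2 + 1\<close> the velocity, and \<open>- N5\<close> puts the last block of
\<open>x\<close>, which has the components 6 and 7, into every block.\<close>

lemma dg_step_stages:
  fixes lam h :: real
  assumes L: "L = mat_of_rows_list 2 [[0, 1], [- lam, 0]]" and h: "h \<noteq> 0"
    and x: "x \<in> carrier_vec 8" and x': "x' \<in> carrier_vec 8"
    and step: "dg_step L h n x x'" and i: "i < 4"
  shows "x' $ (i * 2) = x $ 6 + h * (\<Sum>j<4. lobatto_A $$ (i, j) * x' $ (j * 2 + 1))"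
    and "x' $ (i * 2 + 1) = x $ 7 - h * lam * (\<Sum>j<4. lobatto_A $$ (i, j) * x' $ (j * 2))"
proof -
  have C: "1\<^sub>m 4 \<in> carrier_mat 4 4" "1\<^sub>m 2 \<in> carrier_mat 2 2" "dg_N4 h n \<in> carrier_mat 4 4"
    "dg_N5 h n \<in> carrier_mat 4 4" "L \<in> carrier_mat 2 2"
    using lobatto_A_carrier by (auto simp: dg_N4_eq[OF h] dg_N5_eq[OF h] L mat_2_entries mat_2_carrier)
  have I: "kron (1\<^sub>m 4) (1\<^sub>m 2) \<in> carrier_mat 8 (8::nat)"
    and K: "kron (dg_N4 h n) L \<in> carrier_mat 8 8"
    and K5: "kron (dg_N5 h n) (1\<^sub>m 2) \<in> carrier_mat 8 8"
    using kron_carrier[OF C(1,2)] kron_carrier[OF C(3,5)] kron_carrier[OF C(4,2)] by simp_all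
  have row: "(kron (1\<^sub>m 4) (1\<^sub>m 2) *\<^sub>v x') $ (i * 2 + a) - (kron (dg_N4 h n) L *\<^sub>v x') $ (i * 2 + a)
      = - (kron (dg_N5 h n) (1\<^sub>m 2) *\<^sub>v x) $ (i * 2 + a)" if a: "a < 2" for a
  proof -
    have lt: "i * 2 + a < 8" using i a by linarith
    have "(kron (1\<^sub>m 4) (1\<^sub>m 2) - kron (dg_N4 h n) L) *\<^sub>v x' =
        kron (1\<^sub>m 4) (1\<^sub>m 2) *\<^sub>v x' - kron (dg_N4 h n) L *\<^sub>v x'"
      by (rule minus_mult_distrib_mat_vec[OF I K x'])
    moreover have "(- kron (dg_N5 h n) (1\<^sub>m 2)) *\<^sub>v x = - (kron (dg_N5 h n) (1\<^sub>m 2) *\<^sub>v x)"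
      using K5 x by (intro uminus_mult_mat_vec) auto
    ultimately have "kron (1\<^sub>m 4) (1\<^sub>m 2) *\<^sub>v x' - kron (dg_N4 h n) L *\<^sub>v x' =
        - (kron (dg_N5 h n) (1\<^sub>m 2) *\<^sub>v x)"
      using step by (simp add: dg_step_def)
    then have "(kron (1\<^sub>m 4) (1\<^sub>m 2) *\<^sub>v x' - kron (dg_N4 h n) L *\<^sub>v x') $ (i * 2 + a) =
        (- (kron (dg_N5 h n) (1\<^sub>m 2) *\<^sub>v x)) $ (i * 2 + a)"
      by simp
    then show ?thesis using I K K5 lt by simp
  qed
  have x4: "x \<in> carrier_vec (4 * 2)" "x' \<in> carrier_vec (4 * 2)" using x x' by simp_all
  have id_row: "(kron (1\<^sub>m 4) (1\<^sub>m 2) *\<^sub>v x') $ (i * 2 + a) = x' $ (i * 2 + a)" if a: "a < 2" for a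
  proof -
    have "(\<Sum>b<2. 1\<^sub>m 2 $$ (a, b) * x' $ (j * 2 + b)) = x' $ (j * 2 + a)" for j
    proof -
      have "(\<Sum>b<2. 1\<^sub>m 2 $$ (a, b) * x' $ (j * 2 + b)) =
          (\<Sum>b<2. if a = b then x' $ (j * 2 + b) else 0)"
        using a by (intro sum.cong) auto
      then show ?thesis using a by simp
    qed
    then have "(kron (1\<^sub>m 4) (1\<^sub>m 2) *\<^sub>v x') $ (i * 2 + a) =
        (\<Sum>j<4. 1\<^sub>m 4 $$ (i, j) * x' $ (j * 2 + a))"
      using kron_mult_vec_index[OF C(1,2) x4(2) i a] by simp
    also have "\<dots> = (\<Sum>j<4. if i = j then x' $ (j * 2 + a) else 0)"
      using i by (intro sum.cong) auto
    finally show ?thesis using i by simp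
  qed
  have N5_row: "(kron (dg_N5 h n) (1\<^sub>m 2) *\<^sub>v x) $ (i * 2 + a) = - x $ (6 + a)" if a: "a < 2" for a
    using kron_mult_vec_index[OF C(4,2) x4(1) i a] i a less_2_cases[OF a]
    by (auto simp: dg_N5_eq[OF h] sum_lessThan_4 sum_lessThan_2 simp del: One_nat_def)
  have N4_row: "(kron (dg_N4 h n) L *\<^sub>v x') $ (i * 2 + a) =
      h * (\<Sum>j<4. lobatto_A $$ (i, j) * (\<Sum>b<2. L $$ (a, b) * x' $ (j * 2 + b)))" if a: "a < 2" for a
    using kron_mult_vec_index[OF C(3,5) x4(2) i a] i lobatto_A_carrier
    by (simp add: dg_N4_eq[OF h] sum_distrib_left mult.assoc cong: sum.cong_simp)
  show "x' $ (i * 2) = x $ 6 + h * (\<Sum>j<4. lobatto_A $$ (i, j) * x' $ (j * 2 + 1))"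
    using row[of 0] id_row[of 0] N5_row[of 0] N4_row[of 0]
    by (simp add: L sum_lessThan_2 mat_2_entries mat_2_carrier del: One_nat_def)
  show "x' $ (i * 2 + 1) = x $ 7 - h * lam * (\<Sum>j<4. lobatto_A $$ (i, j) * x' $ (j * 2))"
    using row[of 1] id_row[of 1] N5_row[of 1] N4_row[of 1]
    by (simp add: L sum_lessThan_2 mat_2_entries mat_2_carrier sum_distrib_left sum_negf mult_ac
        del: One_nat_def)
qed

lemma lobatto_b_dim: "dim_vec lobatto_b = 4"
  by (simp add: lobatto_b_def)

lemma rk_step_carrier:
  assumes "rk_step A b L h z k z'" "L \<in> carrier_mat d d" "i < dim_vec b"
  shows "k i \<in> carrier_vec d"
  using assms by (auto simp: rk_step_def Let_def)

text \<open>The vectors \<open>y\<^sub>i = L\<^sup>-\<^sup>1 k\<^sub>i\<close> have the components \<open>- k\<^sub>i\<^sub>1 / lam\<close> and \<open>k\<^sub>i\<^sub>0\<close>. Expressed in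
them, the stage equations take the form of the DG blocks. The update has the weights of the
last stage equation, as the last row of \<open>A\<close> is \<open>b\<close>; hence it returns \<open>y\<^sub>3\<close>.\<close>

lemma rk_step_stages:
  fixes lam h :: real
  assumes L: "L = mat_of_rows_list 2 [[0, 1], [- lam, 0]]" and lam: "lam \<noteq> 0"
    and z: "z \<in> carrier_vec 2" and step: "rk_step lobatto_A lobatto_b L h z k z'"
  shows "i < 4 \<Longrightarrow> - k i $ 1 / lam = z $ 0 + h * (\<Sum>j<4. lobatto_A $$ (i, j) * k j $ 0)"
    and "i < 4 \<Longrightarrow> k i $ 0 = z $ 1 - h * lam * (\<Sum>j<4. lobatto_A $$ (i, j) * (- k j $ 1 / lam))"
    and "z' \<in> carrier_vec 2" "z' $ 0 = - k 3 $ 1 / lam" "z' $ 1 = k 3 $ 0"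
proof -
  have k: "k i \<in> carrier_vec 2" if "i < 4" for i
    using rk_step_carrier[OF step, of 2 i] that by (simp add: L mat_2_entries mat_2_carrier lobatto_b_dim)
  have dL: "dim_row L = 2" using carrier_matD(1)[OF mat_2_carrier] by (simp add: L)
  \<comment> \<open>Every stage argument and the update itself are of this form, for the rows of \<open>A\<close> and for \<open>b\<close>.\<close>
  define v where "v c = z + h \<cdot>\<^sub>v finsum_vec TYPE(real) 2 (\<lambda>j. c j \<cdot>\<^sub>v k j) {..<4}" for c
  have fin: "finsum_vec TYPE(real) 2 (\<lambda>j. c j \<cdot>\<^sub>v k j) {..<4} \<in> carrier_vec 2" for c
    using k by (intro finsum_vec_closed) auto
  then have v: "v c \<in> carrier_vec 2" for c
    using z by (simp add: v_def)
  have v_index: "v c $ a = z $ a + h * (\<Sum>j<4. c j * k j $ a)" if a: "a < 2" for c a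
  proof -
    have "finsum_vec TYPE(real) 2 (\<lambda>j. c j \<cdot>\<^sub>v k j) {..<4} $ a = (\<Sum>j<4. (c j \<cdot>\<^sub>v k j) $ a)"
      using k a by (intro index_finsum_vec) auto
    also have "\<dots> = (\<Sum>j<4. c j * k j $ a)"
      using carrier_vecD[OF k] a by (intro sum.cong) auto
    finally show ?thesis
      using fin[of c] z a unfolding v_def by simp
  qed
  have kv: "k i = L *\<^sub>v v (\<lambda>j. lobatto_A $$ (i, j))" if "i < 4" for i
    using step that by (simp add: rk_step_def Let_def lobatto_b_dim dL v_def)
  have k0: "k i $ 0 = z $ 1 + h * (\<Sum>j<4. lobatto_A $$ (i, j) * k j $ 1)"
    and k1: "k i $ 1 = - lam * (z $ 0 + h * (\<Sum>j<4. lobatto_A $$ (i, j) * k j $ 0))"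
    if "i < 4" for i
    using arg_cong[OF kv[OF that], of "\<lambda>x. x $ 0"] arg_cong[OF kv[OF that], of "\<lambda>x. x $ 1"]
    by (simp_all add: L mat_2_mult_vec[OF v] v_index del: One_nat_def)
  show stage0: "- k i $ 1 / lam = z $ 0 + h * (\<Sum>j<4. lobatto_A $$ (i, j) * k j $ 0)" if "i < 4" for i
    unfolding k1[OF that] using lam by simp
  have "lam * (\<Sum>j<4. lobatto_A $$ (i, j) * (- k j $ 1 / lam)) =
      - (\<Sum>j<4. lobatto_A $$ (i, j) * k j $ 1)" for i
    using lam by (simp add: sum_distrib_left sum_negf)
  then show stage1: "k i $ 0 = z $ 1 - h * lam * (\<Sum>j<4. lobatto_A $$ (i, j) * (- k j $ 1 / lam))"
    if "i < 4" for i
    unfolding k0[OF that] mult.assoc by simp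
  have z': "z' = v (\<lambda>j. lobatto_b $ j)"
    using step by (simp add: rk_step_def Let_def lobatto_b_dim dL v_def)
  then show "z' \<in> carrier_vec 2" using v by simp
  have last: "(\<Sum>j<4. lobatto_b $ j * k j $ a) = (\<Sum>j<4. lobatto_A $$ (3, j) * k j $ a)" for a
    using lobatto_A_last_row by (intro sum.cong) auto
  show "z' $ 0 = - k 3 $ 1 / lam"
    using stage0[of 3] by (simp add: z' v_index last)
  show "z' $ 1 = k 3 $ 0"
    using k0[of 3] by (simp add: z' v_index last del: One_nat_def)
qed

text \<open>Both the blocks of \<open>x'\<close> and the vectors \<open>L\<^sup>-\<^sup>1 k\<^sub>i\<close> solve the stage equations with the same
initial value \<open>z\<close>, so they agree; the last block is the new value of both schemes.\<close>

lemma dg_step_eq_rk_step: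
  fixes lam h :: real
  assumes L: "L = mat_of_rows_list 2 [[0, 1], [- lam, 0]]" and lam: "lam > 0" and h: "h \<noteq> 0"
    and z: "z \<in> carrier_vec 2" and rk: "rk_step lobatto_A lobatto_b L h z k z'"
    and x: "x \<in> carrier_vec 8" and x': "x' \<in> carrier_vec 8" and dg: "dg_step L h n x x'"
    and start: "comps78 x = z"
  shows "z' \<in> carrier_vec 2" "comps78 x' = z'" "x' = kron (1\<^sub>m 4) (mat_inv L) *\<^sub>v stack4 k"
proof -
  have lam0: "lam \<noteq> 0" using lam by simp
  note rks = rk_step_stages[OF L lam0 z rk]
  have k: "k i \<in> carrier_vec 2" if "i < 4" for i
    using rk_step_carrier[OF rk, of 2 i] that by (simp add: L mat_2_entries mat_2_carrier lobatto_b_dim)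
  have zx: "x $ 6 = z $ 0" "x $ 7 = z $ 1"
    by (simp_all add: start[symmetric] comps78_def vec_of_list_index)
  have eq: "x' $ (i * 2) = - k i $ 1 / lam \<and> x' $ (i * 2 + 1) = k i $ 0" if "i < 4" for i
    by (rule oscillator_stages_unique[OF lam h
          dg_step_stages[OF L h x x' dg, unfolded zx] rks(1,2) that])
  show "z' \<in> carrier_vec 2" by (rule rks(3))
  show "comps78 x' = z'"
  proof (rule eq_vecI)
    fix a assume "a < dim_vec z'"
    then have "a = 0 \<or> a = 1" using rks(3) by auto
    then show "comps78 x' $ a = z' $ a"
      using eq[of 3] rks(4,5) by (auto simp: comps78_def vec_of_list_index)
  qed (use rks(3) in \<open>simp add: comps78_def\<close>)
  have C: "1\<^sub>m 4 \<in> carrier_mat 4 4" "mat_inv L \<in> carrier_mat 2 2" and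
    S: "stack4 k \<in> carrier_vec (4 * 2)"
    using stack4_carrier[OF k] by (simp_all add: L mat_inv_oscillator[OF lam0] mat_2_entries mat_2_carrier)
  have block: "(kron (1\<^sub>m 4) (mat_inv L) *\<^sub>v stack4 k) $ (i * 2 + a) =
      (\<Sum>b<2. mat_inv L $$ (a, b) * k i $ b)" if i: "i < 4" and a: "a < 2" for i a
  proof -
    have "(kron (1\<^sub>m 4) (mat_inv L) *\<^sub>v stack4 k) $ (i * 2 + a) =
        (\<Sum>j<4. 1\<^sub>m 4 $$ (i, j) * (\<Sum>b<2. mat_inv L $$ (a, b) * stack4 k $ (j * 2 + b)))"
      by (rule kron_mult_vec_index[OF C S i a])
    also have "\<dots> = (\<Sum>j<4. if i = j then \<Sum>b<2. mat_inv L $$ (a, b) * k j $ b else 0)"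
      using i stack4_index[OF k] by (intro sum.cong) (auto intro!: sum.cong)
    finally show ?thesis using i by simp
  qed
  show "x' = kron (1\<^sub>m 4) (mat_inv L) *\<^sub>v stack4 k"
  proof (rule eq_vec8I[OF x'])
    show "kron (1\<^sub>m 4) (mat_inv L) *\<^sub>v stack4 k \<in> carrier_vec 8"
      using kron_carrier[OF C] S by simp
    fix i :: nat assume i: "i < 4"
    show "x' $ (i * 2) = (kron (1\<^sub>m 4) (mat_inv L) *\<^sub>v stack4 k) $ (i * 2) \<and>
        x' $ (i * 2 + 1) = (kron (1\<^sub>m 4) (mat_inv L) *\<^sub>v stack4 k) $ (i * 2 + 1)"
      using eq[OF i] block[OF i, of 0] block[OF i, of 1]
      by (simp add: L mat_inv_oscillator[OF lam0] sum_lessThan_2 mat_2_entries mat_2_carrier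
          del: One_nat_def)
  qed
qed

text \<open>The invariant \<open>[zh n]\<^sub>7\<^sub>8 = z n\<close> passes from step to step, and each step from such a state yields the
formula for the stacked stages.\<close>

theorem corollary11:
  fixes lam T \<Delta>t :: real and N :: nat and L :: "real mat"
    and z zh :: "nat \<Rightarrow> real vec" and k :: "nat \<Rightarrow> nat \<Rightarrow> real vec"
  assumes "lam > 0" and "T > 0" and "N \<ge> 1"
    and "L = mat_of_rows_list 2 [[0, 1], [- lam, 0]]"
    and "\<Delta>t = T / real N"
    and "z 0 \<in> carrier_vec 2"
    and "\<And>n. n < N \<Longrightarrow> rk_step lobatto_A lobatto_b L \<Delta>t (z n) (k n) (z (Suc n))"
    and "\<And>n. n \<le> N \<Longrightarrow> zh n \<in> carrier_vec 8"
    and "\<And>n. n < N \<Longrightarrow> dg_step L \<Delta>t (int n) (zh n) (zh (Suc n))"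
    and "comps78 (zh 0) = z 0"
  shows "\<forall>n\<in>{1..N}. comps78 (zh n) = z n \<and>
           zh n = kron (1\<^sub>m 4) (mat_inv L) *\<^sub>v stack4 (k (n - 1))"
proof -
  have h: "\<Delta>t \<noteq> 0" using assms(2,3,5) by simp
  note one_step = dg_step_eq_rk_step[OF assms(4,1) h]
  have inv: "z n \<in> carrier_vec 2 \<and> comps78 (zh n) = z n" if "n \<le> N" for n
    using that
  proof (induction n)
    case 0
    then show ?case using assms(6,10) by simp
  next
    case (Suc n)
    then have "n < N" and "z n \<in> carrier_vec 2" "comps78 (zh n) = z n" by auto
    then show ?case
      using one_step(1,2)[OF _ assms(7) assms(8) assms(8) assms(9)] by simp
  qed
  show ?thesis
  proof
    fix n assume "n \<in> {1..N}"
    then obtain m where n: "n = Suc m" and m: "m < N"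
      by (cases n) auto
    have "zh (Suc m) = kron (1\<^sub>m 4) (mat_inv L) *\<^sub>v stack4 (k m)"
      using inv[of m] m one_step(3)[OF _ assms(7) assms(8) assms(8) assms(9)] by simp
    then show "comps78 (zh n) = z n \<and> zh n = kron (1\<^sub>m 4) (mat_inv L) *\<^sub>v stack4 (k (n - 1))"
      using inv[of n] n m by simp
  qed
qed

end
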